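(* Let $d\ge 1$ and let $P$ be a Borel probability measure on $\mathbb{R}^d$ with contiguous support. Let $\delta>0$ and assume that the floating body $P_{[\delta]}$ of $P$ exists. Then $$P_\delta^{FB}=P_\delta=P_{[\delta]},$$ where $P_\delta^{FB}$ is the convex floating body of $P$ with index $\delta$ and $P_\delta$ is the halfspace depth central region of $P$ at level $\delta$.
   Context: For a hyperplane $H$ in $\mathbb{R}^d$, $H^-$ and $H^+$ denote the two closed halfspaces bounded by $H$ (either one may be called $H^-$; the other is then $H^+$). Halfspace depth: $hD(x;P)=\inf\{P(H^-): H \text{ a hyperplane},\ x\in H^-\}$ for $x\in\mathbb{R}^d$. Central region: $P_\delta=\{y\in\mathbb{R}^d: hD(y;P)\ge\delta\}$. Convex floating body of a measure: $P_\delta^{FB}=\bigcap_{P(H^-)\le\delta}H^+$, the intersection being over all hyperplanes $H$ and choices of closed halfspace $H^-$ bounded by $H$ with $P(H^-)\le\delta$ (an empty intersection is $\mathbb{R}^d$). Contiguous support: $P$ has contiguous support if there are no two disjoint closed halfspaces $H_1^-,H_2^-$ with $P(H_1^-)>0$, $P(H_2^-)>0$ and $P(H_1^-)+P(H_2^-)=1$. Supporting halfspace: a closed halfspace $H^+$ supports a set $K\subset\mathbb{R}^d$ if $K\subseteq H^+$ and $K\cap H^-\neq\emptyset$. Floating body of a measure: for $\delta>0$, a convex body (compact convex set with non-empty interior) $P_{[\delta]}\subset\mathbb{R}^d$ is the floating body of $P$ with index $\delta$ if for each supporting halfspace $H^+$ of $P_{[\delta]}$ one has $P(H^-)=\delta$.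 The floating body is said to exist if there is such a set; when $P$ has contiguous support it is unique if it exists. *)

theory Defs
  imports "HOL-Probability.Probability"
begin

text \<open>
  The space \<open>\<real>\<^sup>d\<close> with \<open>d \<ge> 1\<close> is an arbitrary type of class \<open>euclidean_space\<close>
  (so \<open>DIM('a) \<ge> 1\<close> holds automatically).
  \<open>opposite_halfspaces A B\<close> says that \<open>A\<close> and \<open>B\<close> are the two closed halfspaces
  \<open>H\<^sup>-\<close> and \<open>H\<^sup>+\<close> bounded by a common hyperplane; replacing \<open>(u, c)\<close> by
  \<open>(-u, -c)\<close> exchanges the two roles.
\<close>

definition opposite_halfspaces :: "'a::euclidean_space set \<Rightarrow> 'a set \<Rightarrow> bool" where
  "opposite_halfspaces A B \<longleftrightarrow>
     (\<exists>u c. u \<noteq> 0 \<and> A = {x. u \<bullet> x \<le> c} \<and> B = {x. u \<bullet> x \<ge> c})"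

definition closed_halfspace :: "'a::euclidean_space set \<Rightarrow> bool" where
  "closed_halfspace A \<longleftrightarrow> (\<exists>B. opposite_halfspaces A B)"

definition halfspace_depth :: "'a::euclidean_space measure \<Rightarrow> 'a \<Rightarrow> real" where
  "halfspace_depth P x = Inf {measure P A | A. closed_halfspace A \<and> x \<in> A}"

definition central_region :: "'a::euclidean_space measure \<Rightarrow> real \<Rightarrow> 'a set" where
  "central_region P \<delta> = {y. halfspace_depth P y \<ge> \<delta>}"

definition convex_floating_body :: "'a::euclidean_space measure \<Rightarrow> real \<Rightarrow> 'a set" where
  "convex_floating_body P \<delta> =
     \<Inter> {B. \<exists>A. opposite_halfspaces A B \<and> measure P A \<le> \<delta>}"

definition contiguous_support :: "'a::euclidean_space measure \<Rightarrow> bool" where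
  "contiguous_support P \<longleftrightarrow>
     \<not> (\<exists>A B. closed_halfspace A \<and> closed_halfspace B \<and> A \<inter> B = {} \<and>
          measure P A > 0 \<and> measure P B > 0 \<and> measure P A + measure P B = 1)"

definition convex_body :: "'a::euclidean_space set \<Rightarrow> bool" where
  "convex_body K \<longleftrightarrow> compact K \<and> convex K \<and> interior K \<noteq> {}"

text \<open>\<open>B\<close> (\<open>= H\<^sup>+\<close>) supports \<open>K\<close>, and \<open>A\<close> (\<open>= H\<^sup>-\<close>) is the opposite halfspace.\<close>

definition supporting_halfspace :: "'a::euclidean_space set \<Rightarrow> 'a set \<Rightarrow> 'a set \<Rightarrow> bool" where
  "supporting_halfspace K A B \<longleftrightarrow> opposite_halfspaces A B \<and> K \<subseteq> B \<and> K \<inter> A \<noteq> {}"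

text \<open>
  A predicate rather than a function: the floating body with index \<open>\<delta>\<close> exists iff
  some \<open>K\<close> satisfies it.
\<close>

definition is_floating_body :: "'a::euclidean_space measure \<Rightarrow> real \<Rightarrow> 'a set \<Rightarrow> bool" where
  "is_floating_body P \<delta> K \<longleftrightarrow>
     convex_body K \<and> (\<forall>A B. supporting_halfspace K A B \<longrightarrow> measure P A = \<delta>)"

end

theory Submission
  imports Defs
begin

text \<open>
  Contiguity makes \<open>c \<mapsto> P {x. u \<bullet> x \<le> c}\<close> strictly increasing wherever its values lie
  strictly between 0 and 1.
  For each \<open>u \<noteq> 0\<close> this function takes the value \<open>\<delta>\<close> at \<open>Min\<^sub>K u\<close>, the minimum of
  \<open>u \<bullet> x\<close> over \<open>K\<close>, and \<open>\<delta> < 1\<close> because the supporting halfspaces in the two directions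
  \<open>u\<close> and \<open>-u\<close> are disjoint and both have measure \<open>\<delta>\<close>.
  Hence moving a supporting hyperplane changes the measure strictly, and the three bodies are cut
  out by the same halfspaces.
\<close>

lemma opposite_halfspacesI:
  "u \<noteq> 0 \<Longrightarrow> opposite_halfspaces {x. u \<bullet> x \<le> c} {x. u \<bullet> x \<ge> c}"
  unfolding opposite_halfspaces_def by blast

lemma closed_halfspace_le: "u \<noteq> 0 \<Longrightarrow> closed_halfspace {x. u \<bullet> x \<le> c}"
  unfolding closed_halfspace_def using opposite_halfspacesI by blast

lemma closed_halfspace_ge:
  assumes "u \<noteq> 0"
  shows "closed_halfspace {x. u \<bullet> x \<ge> c}"
  using closed_halfspace_le[of "- u" "- c"] assms by simp

lemma closed_halfspaceE:
  assumes "closed_halfspace A"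
  obtains u c where "u \<noteq> 0" "A = {x. u \<bullet> x \<le> c}"
  using assms unfolding closed_halfspace_def opposite_halfspaces_def by blast

lemma halfspace_depth_le:
  assumes "closed_halfspace A" "x \<in> A"
  shows "halfspace_depth P x \<le> measure P A"
  unfolding halfspace_depth_def using assms
  by (intro cInf_lower bdd_belowI[where m = 0]) auto

lemma halfspace_depth_ge:
  fixes x :: "'a::euclidean_space"
  assumes "\<And>A. closed_halfspace A \<Longrightarrow> x \<in> A \<Longrightarrow> \<delta> \<le> measure P A"
  shows "\<delta> \<le> halfspace_depth P x"
proof -
  \<comment> \<open>\<open>cInf_greatest\<close> requires a non-empty set, so some closed halfspace
    through \<open>x\<close> has to be exhibited.\<close>
  obtain u :: 'a where "u \<noteq> 0"
    using nonempty_Basis nonzero_Basis by blast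
  then have "closed_halfspace {y. u \<bullet> y \<le> u \<bullet> x}"
    by (rule closed_halfspace_le)
  then show ?thesis
    unfolding halfspace_depth_def using assms by (intro cInf_greatest) auto
qed

text \<open>If the measure did not grow from \<open>a\<close> to \<open>b\<close>, the disjoint
  halfspaces below \<open>a\<close> and above \<open>b\<close> would both have positive measure and
  together carry all the mass, which contiguity forbids.\<close>

lemma contiguous_support_strict:
  fixes P :: "'a::euclidean_space measure"
  assumes "prob_space P" "sets P = sets borel" "contiguous_support P" "u \<noteq> 0" "a < b"
    and pos: "measure P {x. u \<bullet> x \<le> a} > 0" and lt1: "measure P {x. u \<bullet> x \<le> b} < 1"
  shows "measure P {x. u \<bullet> x \<le> a} < measure P {x. u \<bullet> x \<le> b}"
proof (rule ccontr)
  interpret prob_space P by fact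
  have space: "space P = UNIV"
    using sets_eq_imp_space_eq[OF assms(2)] by simp
  have meas [measurable]: "{x. u \<bullet> x \<le> c} \<in> sets P" "{x. u \<bullet> x < c} \<in> sets P"
    "{x. u \<bullet> x \<ge> c} \<in> sets P" for c
    unfolding assms(2) by auto
  assume "\<not> ?thesis"
  then have le: "prob {x. u \<bullet> x \<le> b} \<le> prob {x. u \<bullet> x \<le> a}" by simp
  \<comment> \<open>The open halfspace is squeezed between two closed ones of equal measure; its
    complement is the second closed halfspace needed.\<close>
  have "prob {x. u \<bullet> x \<le> a} \<le> prob {x. u \<bullet> x < b}"
    using \<open>a < b\<close> by (intro finite_measure_mono meas) auto
  moreover have "prob {x. u \<bullet> x < b} \<le> prob {x. u \<bullet> x \<le> b}"
    by (intro finite_measure_mono meas) auto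
  moreover have "prob {x. u \<bullet> x \<ge> b} = 1 - prob {x. u \<bullet> x < b}"
  proof -
    have "{x. u \<bullet> x \<ge> b} = space P - {x. u \<bullet> x < b}"
      using space by auto
    then show ?thesis
      using prob_compl[OF meas(2)] by simp
  qed
  ultimately have "prob {x. u \<bullet> x \<le> a} + prob {x. u \<bullet> x \<ge> b} = 1" "prob {x. u \<bullet> x \<ge> b} > 0"
    using le lt1 by linarith+
  moreover have "{x. u \<bullet> x \<le> a} \<inter> {x. u \<bullet> x \<ge> b} = {}"
    using \<open>a < b\<close> by auto
  ultimately show False
    using assms(3) pos closed_halfspace_le[OF \<open>u \<noteq> 0\<close>] closed_halfspace_ge[OF \<open>u \<noteq> 0\<close>]
    unfolding contiguous_support_def by blast
qed

lemma convex_body_min_inner: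
  assumes "convex_body K"
  obtains z where "z \<in> K" "\<And>x. x \<in> K \<Longrightarrow> u \<bullet> z \<le> u \<bullet> x"
proof -
  have "compact K" "K \<noteq> {}"
    using assms interior_subset unfolding convex_body_def by auto
  moreover have "continuous_on K (\<lambda>x. u \<bullet> x)"
    by (intro continuous_intros)
  ultimately show ?thesis
    using continuous_attains_inf[of K "\<lambda>x. u \<bullet> x"] that by blast
qed

text \<open>The hyperplane with normal \<open>u\<close> through a minimiser of
  \<open>u \<bullet> x\<close> on \<open>K\<close> supports \<open>K\<close>, so the defining
  property of the floating body applies to it.\<close>

lemma floating_body_min_inner:
  assumes "is_floating_body P \<delta> K" "u \<noteq> 0"
  obtains z where "z \<in> K" "\<And>x. x \<in> K \<Longrightarrow> u \<bullet> z \<le> u \<bullet> x"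
    "measure P {x. u \<bullet> x \<le> u \<bullet> z} = \<delta>"
proof -
  obtain z where z: "z \<in> K" "\<And>x. x \<in> K \<Longrightarrow> u \<bullet> z \<le> u \<bullet> x"
    using convex_body_min_inner assms(1) unfolding is_floating_body_def by metis
  then have "supporting_halfspace K {x. u \<bullet> x \<le> u \<bullet> z} {x. u \<bullet> x \<ge> u \<bullet> z}"
    unfolding supporting_halfspace_def using opposite_halfspacesI[OF \<open>u \<noteq> 0\<close>] by auto
  with z that assms(1) show ?thesis
    unfolding is_floating_body_def by blast
qed

lemma floating_body_index_less_1:
  fixes P :: "'a::euclidean_space measure"
  assumes "prob_space P" "sets P = sets borel" "is_floating_body P \<delta> K"
  shows "\<delta> < 1"
proof -
  interpret prob_space P by fact
  obtain u :: 'a where u: "u \<noteq> 0"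
    using nonempty_Basis nonzero_Basis by blast
  obtain z where z: "\<And>x. x \<in> K \<Longrightarrow> u \<bullet> z \<le> u \<bullet> x" "prob {x. u \<bullet> x \<le> u \<bullet> z} = \<delta>"
    using floating_body_min_inner[OF assms(3) u] by metis
  \<comment> \<open>A minimiser for \<open>- u\<close> is a maximiser for \<open>u\<close>.\<close>
  obtain w where w: "\<And>x. x \<in> K \<Longrightarrow> u \<bullet> x \<le> u \<bullet> w" "prob {x. u \<bullet> w \<le> u \<bullet> x} = \<delta>"
    using floating_body_min_inner[OF assms(3), of "- u"] u by auto
  obtain p e where pe: "e > 0" "cball p e \<subseteq> K"
    \<comment> \<open>A ball inside \<open>K\<close> gives \<open>K\<close> positive width in
      direction \<open>u\<close>: its centre \<open>p\<close> and the boundary point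
      \<open>q\<close> lie at different heights, which separates the two supporting
      halfspaces.\<close>
    using assms(3) unfolding is_floating_body_def convex_body_def
    by (metis ex_in_conv mem_interior_cball)
  define q where "q = p + (e / norm u) *\<^sub>R u"
  have "p \<in> K" "q \<in> K"
    using pe u by (auto simp: q_def subset_iff dist_norm)
  moreover have "u \<bullet> p < u \<bullet> q"
    using pe u by (simp add: q_def inner_add_right)
  ultimately have "u \<bullet> z < u \<bullet> w"
    using z(1)[of p] w(1)[of q] by linarith
  then have "prob ({x. u \<bullet> x \<le> u \<bullet> z} \<union> {x. u \<bullet> w \<le> u \<bullet> x}) = \<delta> + \<delta>"
    using z(2) w(2) by (subst finite_measure_Union) (auto simp: assms(2))
  then show ?thesis
    using prob_le_1[of "{x. u \<bullet> x \<le> u \<bullet> z} \<union> {x. u \<bullet> w \<le> u \<bullet> x}"] by linarith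
qed

lemma convex_body_separation:
  assumes "convex_body K" "y \<notin> K"
  obtains u where "u \<noteq> 0" "\<And>x. x \<in> K \<Longrightarrow> u \<bullet> y < u \<bullet> x"
proof -
  have "convex K" "closed K" "K \<noteq> {}"
    using assms interior_subset compact_imp_closed unfolding convex_body_def by auto
  then obtain u b where ub: "u \<bullet> y < b" "\<And>x. x \<in> K \<Longrightarrow> b < u \<bullet> x"
    using separating_hyperplane_closed_point[of K y] assms(2) by auto
  \<comment> \<open>For \<open>u = 0\<close>, any point of \<open>K\<close> would give
    \<open>0 < b\<close> and \<open>b < 0\<close>.\<close>
  with \<open>K \<noteq> {}\<close> have "u \<noteq> 0" by force
  with ub that show ?thesis by (meson less_trans)
qed

text \<open>A point outside \<open>K\<close> is cut off by a supporting hyperplane; the halfspace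
  beyond it has measure exactly \<open>\<delta>\<close>, so its opposite takes part in the
  intersection.\<close>

lemma convex_floating_body_subset:
  assumes "is_floating_body P \<delta> K"
  shows "convex_floating_body P \<delta> \<subseteq> K"
proof
  fix y
  assume y: "y \<in> convex_floating_body P \<delta>"
  show "y \<in> K"
  proof (rule ccontr)
    assume "y \<notin> K"
    then obtain u where u: "u \<noteq> 0" "\<And>x. x \<in> K \<Longrightarrow> u \<bullet> y < u \<bullet> x"
      using convex_body_separation assms unfolding is_floating_body_def by metis
    obtain z where z: "z \<in> K" "measure P {x. u \<bullet> x \<le> u \<bullet> z} = \<delta>"
      using floating_body_min_inner[OF assms u(1)] by metis
    then have "y \<in> {x. u \<bullet> x \<ge> u \<bullet> z}"
      using y opposite_halfspacesI[OF u(1), of "u \<bullet> z"] unfolding convex_floating_body_def by blast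
    then show False using u(2)[OF z(1)] by simp
  qed
qed

text \<open>A halfspace cutting off a point of \<open>K\<close> reaches strictly beyond the parallel
  supporting hyperplane, hence has measure above \<open>\<delta>\<close>.\<close>

lemma floating_body_subset_convex_floating_body:
  assumes "prob_space P" "sets P = sets borel" "contiguous_support P" "\<delta> > 0"
    and "is_floating_body P \<delta> K"
  shows "K \<subseteq> convex_floating_body P \<delta>"
proof -
  have "u \<bullet> y \<ge> c"
    if y: "y \<in> K" and u: "u \<noteq> 0" and le: "measure P {x. u \<bullet> x \<le> c} \<le> \<delta>" for y u c
  proof (rule ccontr)
    assume "\<not> u \<bullet> y \<ge> c"
    obtain z where z: "\<And>x. x \<in> K \<Longrightarrow> u \<bullet> z \<le> u \<bullet> x" "measure P {x. u \<bullet> x \<le> u \<bullet> z} = \<delta>"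
      using floating_body_min_inner[OF assms(5) u] by metis
    have "u \<bullet> z < c" using \<open>\<not> u \<bullet> y \<ge> c\<close> z(1)[OF y] by simp
    then show False
      using contiguous_support_strict[OF assms(1-3) u, of "u \<bullet> z" c] z(2) le \<open>\<delta> > 0\<close>
        floating_body_index_less_1[OF assms(1,2,5)] by linarith
  qed
  then show ?thesis
    unfolding convex_floating_body_def opposite_halfspaces_def by blast
qed

text \<open>Every halfspace that meets \<open>K\<close> contains the parallel one bounded by a
  supporting hyperplane, of measure \<open>\<delta>\<close>.\<close>

lemma floating_body_subset_central_region:
  assumes "prob_space P" "sets P = sets borel" "is_floating_body P \<delta> K"
  shows "K \<subseteq> central_region P \<delta>"
proof
  interpret prob_space P by fact
  fix y
  assume y: "y \<in> K"
  have "\<delta> \<le> prob A" if A: "closed_halfspace A" "y \<in> A" for A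
  proof -
    obtain u c where u: "u \<noteq> 0" and A_eq: "A = {x. u \<bullet> x \<le> c}"
      using A(1) by (rule closed_halfspaceE)
    obtain z where z: "\<And>x. x \<in> K \<Longrightarrow> u \<bullet> z \<le> u \<bullet> x" "prob {x. u \<bullet> x \<le> u \<bullet> z} = \<delta>"
      using floating_body_min_inner[OF assms(3) u] by metis
    have "{x. u \<bullet> x \<le> u \<bullet> z} \<subseteq> A"
      using z(1)[OF y] A(2) A_eq by auto
    moreover have "A \<in> sets P"
      by (simp add: A_eq assms(2))
    ultimately show ?thesis
      using finite_measure_mono z(2) by metis
  qed
  then show "y \<in> central_region P \<delta>"
    unfolding central_region_def by (simp add: halfspace_depth_ge)
qed

text \<open>Through a point outside \<open>K\<close> passes a hyperplane strictly below a parallel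
  supporting one, so strict monotonicity pushes the depth of the point below
  \<open>\<delta>\<close>.\<close>

lemma central_region_subset_floating_body:
  assumes "prob_space P" "sets P = sets borel" "contiguous_support P" "\<delta> > 0"
    and "is_floating_body P \<delta> K"
  shows "central_region P \<delta> \<subseteq> K"
proof
  fix y
  assume y: "y \<in> central_region P \<delta>"
  show "y \<in> K"
  proof (rule ccontr)
    assume "y \<notin> K"
    then obtain u where u: "u \<noteq> 0" "\<And>x. x \<in> K \<Longrightarrow> u \<bullet> y < u \<bullet> x"
      using convex_body_separation assms(5) unfolding is_floating_body_def by metis
    obtain z where z: "z \<in> K" "measure P {x. u \<bullet> x \<le> u \<bullet> z} = \<delta>"
      using floating_body_min_inner[OF assms(5) u(1)] by metis
    \<comment> \<open>With \<open>\<delta> > 0\<close> this also supplies the positivity that strict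
      monotonicity asks of the smaller halfspace.\<close>
    have "\<delta> \<le> measure P {x. u \<bullet> x \<le> u \<bullet> y}"
      using y halfspace_depth_le[OF closed_halfspace_le[OF u(1)], of y "u \<bullet> y" P]
      unfolding central_region_def by simp
    then show False
      using contiguous_support_strict[OF assms(1-3) u(1) u(2)[OF z(1)]] z(2) \<open>\<delta> > 0\<close>
        floating_body_index_less_1[OF assms(1,2,5)] by simp
  qed
qed

theorem proposition28:
  fixes P :: "'a::euclidean_space measure" and \<delta> :: real and K :: "'a set"
  assumes "prob_space P" and "sets P = sets borel"
    and "contiguous_support P"
    and "\<delta> > 0"
    and "is_floating_body P \<delta> K"
  shows "convex_floating_body P \<delta> = central_region P \<delta> \<and> central_region P \<delta> = K"
  using convex_floating_body_subset[OF assms(5)]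
    floating_body_subset_convex_floating_body[OF assms]
    floating_body_subset_central_region[OF assms(1,2,5)]
    central_region_subset_floating_body[OF assms]
  by blast

end
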